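(* The smallest positive integer $V$ for which there exists a mono-unstable $0$-skeleton in $\mathbb{R}^3$ with exactly $V$ vertices is $V=11$. That is, there exists a $3$-dimensional convex polytope in $\mathbb{R}^3$ with $11$ vertices that is mono-unstable as a $0$-skeleton, and no $3$-dimensional convex polytope in $\mathbb{R}^3$ with fewer than $11$ vertices is mono-unstable as a $0$-skeleton.
   Context: Let $P\subseteq\mathbb{R}^d$ be a $d$-dimensional (bounded) convex polytope with vertices $r_1,\dots,r_V$. Regarded as a $0$-skeleton, $P$ carries a unit point mass at each of its vertices (and no other mass), so its center of mass is $g=\frac1V\sum_{i=1}^V r_i$, which lies in the interior of $P$. A point $q$ of the boundary of $P$ is an equilibrium point (with respect to $g$) if the hyperplane $h$ through $q$ perpendicular to the line segment $[g,q]$ supports $P$ at $q$. An equilibrium point $q$ is nondegenerate if $h\cap P$ is the unique face of $P$ (of dimension $k\in\{0,1,\dots,d-1\}$) that contains $q$ in its relative interior. A nondegenerate equilibrium point $q$ is unstable if $\dim(h\cap P)=0$; equivalently, $q$ is a vertex of $P$ and $h\cap P=\{q\}$. Only nondegenerate equilibrium points are counted; $U$ denotes the number of unstable equilibria. A $0$-skeleton is mono-unstable if $U=1$. Here $d=3$. *)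

theory Defs
  imports "HOL-Analysis.Analysis"
begin

definition vertices :: "'a::euclidean_space set \<Rightarrow> 'a set" where
  "vertices P = {v. v extreme_point_of P}"

definition skeleton0_center :: "'a::euclidean_space set \<Rightarrow> 'a" where
  "skeleton0_center P = (1 / real (card (vertices P))) *\<^sub>R (\<Sum>v\<in>vertices P. v)"

text \<open>For \<open>q = g\<close> the next set degenerates to the whole space, which is not a hyperplane and
  therefore supports nothing in the sense of \<open>supports_at\<close>.\<close>

definition perp_hyperplane :: "'a::euclidean_space \<Rightarrow> 'a \<Rightarrow> 'a set" where
  "perp_hyperplane g q = {x. (q - g) \<bullet> (x - q) = 0}"

definition supports_at :: "'a::euclidean_space set \<Rightarrow> 'a set \<Rightarrow> 'a \<Rightarrow> bool" where
  "supports_at h P q \<longleftrightarrow> q \<in> h \<inter> P \<and>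
     (\<exists>a b. a \<noteq> 0 \<and> h = {x. a \<bullet> x = b} \<and> P \<subseteq> {x. a \<bullet> x \<le> b})"

definition equilibrium :: "'a::euclidean_space set \<Rightarrow> 'a \<Rightarrow> 'a \<Rightarrow> bool" where
  "equilibrium P g q \<longleftrightarrow> q \<in> frontier P \<and> supports_at (perp_hyperplane g q) P q"

text \<open>The library's \<open>face_of\<close> admits the empty set and \<open>P\<close> itself as faces; the bounds on
  \<open>aff_dim\<close> leave exactly the faces of dimension \<open>0, \<dots>, d - 1\<close>.\<close>

definition nondegenerate_equilibrium :: "'a::euclidean_space set \<Rightarrow> 'a \<Rightarrow> 'a \<Rightarrow> bool" where
  "nondegenerate_equilibrium P g q \<longleftrightarrow> equilibrium P g q \<and>
     {F. F face_of P \<and> 0 \<le> aff_dim F \<and> aff_dim F \<le> int DIM('a) - 1 \<and> q \<in> rel_interior F}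
       = {perp_hyperplane g q \<inter> P}"

definition unstable_equilibrium :: "'a::euclidean_space set \<Rightarrow> 'a \<Rightarrow> 'a \<Rightarrow> bool" where
  "unstable_equilibrium P g q \<longleftrightarrow>
     nondegenerate_equilibrium P g q \<and> aff_dim (perp_hyperplane g q \<inter> P) = 0"

definition num_unstable :: "'a::euclidean_space set \<Rightarrow> 'a \<Rightarrow> nat" where
  "num_unstable P g = card {q. unstable_equilibrium P g q}"

definition mono_unstable_0_skeleton :: "'a::euclidean_space set \<Rightarrow> bool" where
  "mono_unstable_0_skeleton P \<longleftrightarrow> num_unstable P (skeleton0_center P) = 1"

end

theory Submission
  imports Defs
begin

text \<open>Put the center of mass at the origin. A vertex \<open>v\<close> is unstable exactly when
  \<open>v \<bullet> w < v \<bullet> v\<close> for every other vertex \<open>w\<close>, so the farthest vertex always is. The polytope is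
  mono-unstable precisely when every other vertex \<open>v\<close> has a parent \<open>w\<close> with \<open>v \<bullet> v \<le> w \<bullet> v\<close>. This
  says that \<open>v\<close> lies in the Thales ball with diameter \<open>[0, w]\<close>; in particular \<open>v\<close> is shorter than
  \<open>w\<close>, so the parents arrange the vertices into a tree whose root is the farthest vertex. The lower
  bound is therefore a statement about trees of vectors in any inner product space: with at most
  ten nodes, the vectors cannot sum to zero unless the root vanishes.

  There are many trees, but in a fixed direction \<open>c\<close> only the simplest ones matter. Let
  \<open>p x = norm c * norm x - c \<bullet> x\<close>. A child of \<open>x\<close> has inner product at least \<open>- p x / 2\<close> with \<open>c\<close>,
  and a suitable child attains this value. So let \<open>z\<close> be the node with the largest \<open>p z\<close>: the total
  in direction \<open>c\<close> does not grow when all nodes off the path from the root to \<open>z\<close> are replaced by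
  optimal leaves at \<open>z\<close>. What remains is a broom, a path with leaves at its end
  (\<open>broom_below_fan\<close>). An induction along the path of a broom (\<open>supports_brooms_Suc\<close>) bounds the
  total from below in every direction at once, which means that the sum of any forest of \<open>n\<close>
  vectors hanging under \<open>x\<close> lies in a ball with center \<open>D *\<^sub>R x\<close> and radius \<open>\<rho> * norm x\<close>
  (\<open>fan_in_ball\<close>), for explicit pairs \<open>(D, \<rho>)\<close>.

  Now consider a root \<open>x\<close> with nine further nodes. If no branch at \<open>x\<close> has more than four nodes, then
  the total has positive inner product with \<open>x\<close> itself. Otherwise some child \<open>y\<close> carries a branch of
  five or more nodes; the forest under \<open>y\<close> and the rest of the forest under \<open>x\<close> are each confined
  to a ball, and the total stays away from zero because \<open>(1 + D1) *\<^sub>R x + (1 + D2) *\<^sub>R y\<close> is longer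
  than the two radii together (\<open>two_balls_avoid_zero\<close>).

  For eleven vertices a tree that balances exists: two mirrored spirals of five points each,
  starting from a common farthest vertex, form a strictly convex plane polygon with small integer
  coordinates. Lifting one pair of mirrored points to opposite sides of the plane makes it
  three-dimensional.\<close>

section \<open>Forests of vectors\<close>

lemma inner_ge_in_thales_ball:
  fixes x y :: "'a::real_inner"
  assumes "y \<bullet> y \<le> x \<bullet> y"
  shows "- (norm c * norm x - c \<bullet> x) / 2 \<le> c \<bullet> y"
proof -
  have "(norm (2 *\<^sub>R y - x))\<^sup>2 \<le> (norm x)\<^sup>2"
    using assms by (simp add: power2_norm_eq_inner algebra_simps inner_commute)
  then have "norm (2 *\<^sub>R y - x) \<le> norm x"
    using norm_ge_zero power2_le_imp_le by blast
  then have "norm c * norm (2 *\<^sub>R y - x) \<le> norm c * norm x"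
    by (intro mult_left_mono) auto
  moreover have "- (norm c * norm (2 *\<^sub>R y - x)) \<le> c \<bullet> (2 *\<^sub>R y - x)"
    using Cauchy_Schwarz_ineq2[of c "2 *\<^sub>R y - x"] by linarith
  ultimately show ?thesis
    by (simp add: inner_diff_right)
qed

lemma norm_le_in_thales_ball:
  fixes x y :: "'a::real_inner"
  assumes "y \<bullet> y \<le> x \<bullet> y"
  shows "norm y \<le> norm x"
proof -
  have "0 \<le> (x - y) \<bullet> (x - y)" by simp
  then have "y \<bullet> y \<le> x \<bullet> x"
    using assms by (simp add: inner_commute algebra_simps)
  then show ?thesis by (simp add: norm_le)
qed

text \<open>\<open>fan x n s\<close>: some forest of \<open>n\<close> vectors with sum \<open>s\<close> hangs under the parent \<open>x\<close>, each vector lying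
  in the Thales ball of its own parent. The shape of the forest is forgotten on purpose: balancing
  depends on the sum alone, and every argument below is an induction on how the forest was built.\<close>

inductive fan :: "'a::real_inner \<Rightarrow> nat \<Rightarrow> 'a \<Rightarrow> bool" where
  empty: "fan x 0 0"
| branch: "\<lbrakk>fan x n s; y \<bullet> y \<le> x \<bullet> y; fan y m t\<rbrakk> \<Longrightarrow> fan x (n + m + 1) (s + (y + t))"

text \<open>The zero vector lies in every Thales ball, so it can be hung anywhere without changing the sum.\<close>

lemma fan_pad:
  assumes "fan x n s"
  shows "fan x (n + k) s"
proof (induction k)
  case (Suc k)
  show ?case using fan.branch[OF Suc, of 0 0 0] fan.empty[of 0] by simp
qed (use assms in simp)

text \<open>The longest vector \<open>y\<close> of \<open>X\<close> can only have \<open>x\<close> as its parent. Cutting off the subtree of \<open>y\<close> leaves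
  two smaller families, one under \<open>y\<close> and one under \<open>x\<close>, each closed under taking parents up to its new root.\<close>

lemma fan_of_parents:
  fixes par :: "'a::real_inner \<Rightarrow> 'a"
  assumes "finite X" "x \<notin> X"
    and "\<And>v. v \<in> X \<Longrightarrow> par v \<in> insert x X"
    and "\<And>v. v \<in> X \<Longrightarrow> v \<bullet> v \<le> par v \<bullet> v"
    and "\<And>v. v \<in> X \<Longrightarrow> norm v < norm (par v)"
  shows "fan x (card X) (\<Sum>X)"
  using assms
proof (induction "card X" arbitrary: X x rule: less_induct)
  case less
  show ?case
  proof (cases "X = {}")
    case True
    then show ?thesis by (simp add: fan.empty)
  next
    case False
    have "Max (norm ` X) \<in> norm ` X"
      using False less.prems(1) by (intro Max_in) auto
    then obtain y where y: "y \<in> X" "norm y = Max (norm ` X)" by auto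
    then have ymax: "norm v \<le> norm y" if "v \<in> X" for v
      using that less.prems(1) by simp
    have pary: "par y = x"
      using less.prems(3)[OF y(1)] less.prems(5)[OF y(1)] ymax[of "par y"] by auto
    define R where "R = {(v, par v) | v. v \<in> X}"
    define D where "D = {v. (v, y) \<in> R\<^sup>*}"
    have yD: "y \<in> D" by (simp add: D_def)
    have DX: "D \<subseteq> X"
    proof
      fix v assume "v \<in> D"
      then have "(v, y) \<in> R\<^sup>*" by (simp add: D_def)
      then show "v \<in> X"
        by (cases rule: converse_rtranclE) (use y in \<open>auto simp: R_def\<close>)
    qed
    have up: "par v \<in> D" if "v \<in> D" "v \<noteq> y" for v
    proof -
      have "(v, y) \<in> R\<^sup>*" using that by (simp add: D_def)
      then show ?thesis
        by (cases rule: converse_rtranclE) (use that in \<open>auto simp: R_def D_def\<close>)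
    qed
    have down: "v \<in> D" if "v \<in> X" "par v \<in> D" for v
      using that by (auto simp: D_def R_def intro: converse_rtrancl_into_rtrancl)
    have fin: "finite D" using DX less.prems(1) finite_subset by blast
    have "card (X - D) < card X"
      using y(1) yD less.prems(1) by (intro psubset_card_mono) auto
    then have 1: "fan x (card (X - D)) (\<Sum>(X - D))"
      by (rule less.hyps) (use less.prems down in auto)
    have "card (D - {y}) < card X"
      using y(1) DX less.prems(1) by (intro psubset_card_mono) auto
    then have 2: "fan y (card (D - {y})) (\<Sum>(D - {y}))"
      by (rule less.hyps) (use less.prems up DX fin in auto)
    have "card X = card (X - D) + card (D - {y}) + 1"
      using card_Diff_subset[OF fin DX] card_mono[OF less.prems(1) DX] card.remove[OF fin yD]
      by linarith
    moreover have "\<Sum>X = \<Sum>(X - D) + (y + \<Sum>(D - {y}))"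
      using sum.subset_diff[OF DX less.prems(1), of "\<lambda>v. v"] sum.remove[OF fin yD, of "\<lambda>v. v"]
      by (simp only:)
    moreover have "y \<bullet> y \<le> x \<bullet> y" using less.prems(4)[OF y(1)] pary by simp
    ultimately show ?thesis using fan.branch[OF 1 _ 2] by presburger
  qed
qed

section \<open>Paths are the worst forests\<close>

text \<open>\<open>broom c x n q v\<close>: a path leaves \<open>x\<close>, and those of the \<open>n\<close> vectors that are not on the path are leaves
  at its last node \<open>z\<close>. Here \<open>q\<close> is the potential \<open>norm c * norm z - c \<bullet> z\<close>, and \<open>v\<close> is the total inner
  product with \<open>c\<close>, where every leaf counts with the extreme value \<open>- q / 2\<close>.\<close>

inductive broom :: "'a::real_inner \<Rightarrow> 'a \<Rightarrow> nat \<Rightarrow> real \<Rightarrow> real \<Rightarrow> bool" for c where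
  leaves: "q = norm c * norm x - c \<bullet> x \<Longrightarrow> broom c x n q (- (real n / 2) * q)"
| stem: "\<lbrakk>y \<bullet> y \<le> x \<bullet> y; broom c y n q v\<rbrakk> \<Longrightarrow> broom c x (Suc n) q (c \<bullet> y + v)"

lemma broom_add_leaves:
  assumes "broom c x n q v"
  shows "broom c x (n + k) q (v - real k / 2 * q)"
  using assms
proof induction
  case (leaves q x n)
  have "- (real n / 2) * q - real k / 2 * q = - (real (n + k) / 2) * q"
    by (simp add: field_simps)
  then show ?case using broom.leaves[OF leaves, of "n + k"] by metis
next
  case (stem y x n q v)
  then show ?case using broom.stem[OF stem(1) stem(3)] by (simp add: add_diff_eq)
qed

text \<open>The exchange argument. Two brooms under \<open>x\<close> are merged by keeping the one whose last node has the larger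
  potential and hanging all vectors of the other one there as leaves: by the third conjunct, the
  discarded broom was worth no less than that. The last two conjuncts say that the potential at
  the end of the broom is large enough to play this role in the next merge.\<close>

lemma broom_below_fan:
  assumes "fan x n s"
  shows "\<exists>q v. broom c x n q v \<and> v \<le> c \<bullet> s \<and> - (real n / 2) * q \<le> v \<and> norm c * norm x - c \<bullet> x \<le> q"
  using assms
proof induction
  case (empty x)
  show ?case using broom.leaves[OF refl, of c x 0] by fastforce
next
  case (branch x n s y m t)
  then obtain q1 v1 q2 v2 where
    1: "broom c x n q1 v1" "v1 \<le> c \<bullet> s" "- (real n / 2) * q1 \<le> v1" "norm c * norm x - c \<bullet> x \<le> q1" and
    2: "broom c y m q2 v2" "v2 \<le> c \<bullet> t" "- (real m / 2) * q2 \<le> v2" "norm c * norm y - c \<bullet> y \<le> q2"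
    by blast
  have y: "- q1 / 2 \<le> c \<bullet> y"
    using inner_ge_in_thales_ball[OF branch.hyps(2), of c] 1(4) by (simp add: field_simps)
  show ?case
  proof (cases "q2 \<le> q1")
    case True
    then have "real m * q2 \<le> real m * q1" by (intro mult_left_mono) auto
    then show ?thesis
      using broom_add_leaves[OF 1(1), of "m + 1"] y 1 2
      by (intro exI[of _ q1] exI[of _ "v1 - real (m + 1) / 2 * q1"])
        (simp add: algebra_simps add_divide_distrib)
  next
    case False
    then have "real n * q1 \<le> real n * q2" by (intro mult_left_mono) auto
    then show ?thesis
      using broom.stem[OF branch.hyps(2) broom_add_leaves[OF 2(1), of n]] y 1 2 False
      by (intro exI[of _ q2] exI[of _ "c \<bullet> y + (v2 - real n / 2 * q2)"])
        (simp add: algebra_simps add_divide_distrib)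
  qed
qed

section \<open>Balls that contain the sum of a forest\<close>

text \<open>Used for all \<open>c\<close> at once, these linear bounds are the support inequalities of a ball with center
  \<open>D *\<^sub>R x\<close> and radius \<open>\<rho> * norm x\<close>.\<close>

definition supports_brooms :: "'a::real_inner \<Rightarrow> nat \<Rightarrow> real \<Rightarrow> real \<Rightarrow> bool" where
  "supports_brooms c n D \<rho> \<longleftrightarrow>
     (\<forall>x q v. broom c x n q v \<longrightarrow> D * (c \<bullet> x) - \<rho> * (norm c * norm x) \<le> v)"

lemma supports_brooms_0: "supports_brooms c 0 0 0"
  unfolding supports_brooms_def by (auto elim: broom.cases)

lemma binary_form_nonneg:
  fixes A B C h e :: real
  assumes "0 \<le> A" "0 \<le> C" "B\<^sup>2 \<le> A * C"
  shows "0 \<le> A * h\<^sup>2 - 2 * B * (h * e) + C * e\<^sup>2"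
proof -
  have "(B * (h * e))\<^sup>2 \<le> (A * h\<^sup>2) * (C * e\<^sup>2)"
    using mult_right_mono[OF assms(3), of "(h * e)\<^sup>2"] by (simp add: power_mult_distrib algebra_simps)
  then have "B * (h * e) \<le> sqrt ((A * h\<^sup>2) * (C * e\<^sup>2))"
    by (rule real_le_rsqrt)
  also have "\<dots> \<le> (A * h\<^sup>2 + C * e\<^sup>2) / 2"
    using assms by (intro arith_geo_mean_sqrt) auto
  finally show ?thesis by simp
qed

lemma binary_form_pos:
  fixes A B C h e :: real
  assumes "0 < C" "B\<^sup>2 < A * C" "0 < h"
  shows "0 < A * h\<^sup>2 - 2 * B * (h * e) + C * e\<^sup>2"
proof -
  have "C * (A * h\<^sup>2 - 2 * B * (h * e) + C * e\<^sup>2) = (A * C - B\<^sup>2) * h\<^sup>2 + (B * h - C * e)\<^sup>2"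
    by (simp add: power2_eq_square algebra_simps)
  also have "\<dots> > 0" using assms by (intro add_pos_nonneg) auto
  finally show ?thesis using assms(1) by (simp add: zero_less_mult_iff)
qed

text \<open>The two \<open>leaf\<close> conditions compare the bound with that of \<open>n + 1\<close> leaves at \<open>x\<close>, which is linear in
  \<open>c \<bullet> x\<close>, at the extreme values \<open>\<plusminus> norm c * norm x\<close>. For a broom that first steps to \<open>y\<close>, the bound at
  \<open>y\<close> has to imply the one at \<open>x\<close>, which means that the ball belonging to \<open>y\<close> is contained in the ball
  belonging to \<open>x\<close>. Over all \<open>y\<close> in the Thales ball of \<open>x\<close> this is a quadratic inequality in
  \<open>norm x\<close> and \<open>norm y\<close>, and \<open>disc\<close> makes its discriminant nonpositive.\<close>

lemma supports_brooms_Suc: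
  fixes c :: "'a::real_inner"
  assumes B: "supports_brooms c n D \<rho>"
    and D: "0 \<le> D" "D + 1 \<le> 2 * D'" and \<rho>: "0 \<le> \<rho>" "\<rho> \<le> \<rho>'"
    and leaf: "D' \<le> \<rho>'" "real n + 1 - D' \<le> \<rho>'"
    and disc: "\<rho>\<^sup>2 * D'\<^sup>2 \<le> (\<rho>'\<^sup>2 - D'\<^sup>2) * ((D + 1) * (2 * D' - (D + 1)))"
  shows "supports_brooms c (Suc n) D' \<rho>'"
  unfolding supports_brooms_def
proof (intro allI impI)
  fix x q v assume "broom c x (Suc n) q v"
  then show "D' * (c \<bullet> x) - \<rho>' * (norm c * norm x) \<le> v"
  proof cases
    case leaves
    define k where "k = (real n + 1) / 2"
    have "\<bar>D' - k\<bar> \<le> \<rho>' - k" using leaf unfolding k_def by (auto simp: field_simps)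
    have "(D' - k) * (c \<bullet> x) \<le> \<bar>D' - k\<bar> * \<bar>c \<bullet> x\<bar>"
      by (metis abs_ge_self abs_mult)
    also have "\<dots> \<le> (\<rho>' - k) * (norm c * norm x)"
      using \<open>\<bar>D' - k\<bar> \<le> \<rho>' - k\<close> Cauchy_Schwarz_ineq2[of c x] by (intro mult_mono) auto
    finally have "D' * (c \<bullet> x) - \<rho>' * (norm c * norm x) \<le> - k * q"
      unfolding leaves(2) by (simp add: algebra_simps)
    then show ?thesis unfolding leaves(1) k_def by (simp add: add.commute)
  next
    case (stem y v')
    define h e k where "h = norm x" and "e = norm y" and "k = (D + 1) * (2 * D' - (D + 1))"
    have k: "0 \<le> k" using D by (simp add: k_def)
    have he: "0 \<le> e" "e \<le> h" "0 \<le> h"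
      using norm_le_in_thales_ball[OF stem(2)] by (auto simp: h_def e_def)
    have "(norm ((D + 1) *\<^sub>R y - D' *\<^sub>R x))\<^sup>2
        = (D + 1)\<^sup>2 * e\<^sup>2 + D'\<^sup>2 * h\<^sup>2 - 2 * D' * (D + 1) * (x \<bullet> y)"
      unfolding h_def e_def power2_norm_eq_inner
      by (simp add: inner_diff_left inner_diff_right inner_commute power2_eq_square algebra_simps)
    also have "\<dots> \<le> (D + 1)\<^sup>2 * e\<^sup>2 + D'\<^sup>2 * h\<^sup>2 - 2 * D' * (D + 1) * e\<^sup>2"
      using stem(2) D unfolding e_def power2_norm_eq_inner
      by (intro diff_left_mono mult_left_mono) auto
    also have "\<dots> = D'\<^sup>2 * h\<^sup>2 - k * e\<^sup>2"
      by (simp add: k_def power2_eq_square algebra_simps)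
    also have "\<dots> \<le> (\<rho>' * h - \<rho> * e)\<^sup>2"
    proof -
      have "0 \<le> (\<rho>'\<^sup>2 - D'\<^sup>2) * h\<^sup>2 - 2 * (\<rho> * \<rho>') * (h * e) + (\<rho>\<^sup>2 + k) * e\<^sup>2"
      proof (rule binary_form_nonneg)
        show "0 \<le> \<rho>'\<^sup>2 - D'\<^sup>2" using leaf D by (simp add: power_mono)
        show "(\<rho> * \<rho>')\<^sup>2 \<le> (\<rho>'\<^sup>2 - D'\<^sup>2) * (\<rho>\<^sup>2 + k)"
          using disc unfolding k_def by (simp add: power_mult_distrib algebra_simps)
      qed (use k in simp)
      then show ?thesis by (simp add: power2_eq_square algebra_simps)
    qed
    finally have "norm ((D + 1) *\<^sub>R y - D' *\<^sub>R x) \<le> \<rho>' * h - \<rho> * e"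
      by (rule power2_le_imp_le) (use \<rho> he in \<open>simp add: mult_mono\<close>)
    then have "norm c * norm ((D + 1) *\<^sub>R y - D' *\<^sub>R x) \<le> norm c * (\<rho>' * h - \<rho> * e)"
      by (intro mult_left_mono) auto
    moreover have "- (norm c * norm ((D + 1) *\<^sub>R y - D' *\<^sub>R x)) \<le> c \<bullet> ((D + 1) *\<^sub>R y - D' *\<^sub>R x)"
      using Cauchy_Schwarz_ineq2[of c "(D + 1) *\<^sub>R y - D' *\<^sub>R x"] by linarith
    moreover have "D * (c \<bullet> y) - \<rho> * (norm c * e) \<le> v'"
      using B stem unfolding supports_brooms_def e_def by blast
    ultimately show ?thesis
      using stem(1) by (simp add: h_def inner_diff_right algebra_simps)
  qed
qed

lemma fan_in_ball:
  fixes x s :: "'a::real_inner"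
  assumes "\<And>c::'a. supports_brooms c n D \<rho>" "0 \<le> \<rho>" "fan x n s"
  shows "norm (s - D *\<^sub>R x) \<le> \<rho> * norm x"
proof -
  define c where "c = D *\<^sub>R x - s"
  obtain q v where "broom c x n q v" "v \<le> c \<bullet> s"
    using broom_below_fan[OF assms(3)] by blast
  then have "D * (c \<bullet> x) - \<rho> * (norm c * norm x) \<le> c \<bullet> s"
    using assms(1)[of c] unfolding supports_brooms_def by fastforce
  then have "c \<bullet> c \<le> \<rho> * (norm c * norm x)"
    by (simp add: c_def inner_diff_right)
  then have "norm c * norm c \<le> norm c * (\<rho> * norm x)"
    by (simp add: power2_norm_eq_inner[symmetric] power2_eq_square ac_simps)
  then have "norm c \<le> \<rho> * norm x" if "c \<noteq> 0"
    using that by simp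
  then show ?thesis
    using assms(2) by (cases "c = 0") (auto simp: c_def norm_minus_commute)
qed

text \<open>For each \<open>D'\<close> the preceding lemma determines a least \<open>\<rho>'\<close>, so a chain of bounds has one free
  parameter per step. These values come from a numerical search for a chain that leaves room in all
  the final inequalities; \<open>D\<close> and \<open>\<rho>\<close> are then rounded to hundredths, \<open>\<rho>\<close> upwards.\<close>

lemma main_balls:
  shows supports_brooms_1: "supports_brooms c 1 (1/2) (1/2)"
    and supports_brooms_2: "supports_brooms c 2 (88/100) (113/100)"
    and supports_brooms_3: "supports_brooms c 3 (125/100) (181/100)"
    and supports_brooms_4: "supports_brooms c 4 (165/100) (255/100)"
    and supports_brooms_5: "supports_brooms c 5 (202/100) (336/100)"
    and supports_brooms_6: "supports_brooms c 6 (256/100) (427/100)"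
    and supports_brooms_7: "supports_brooms c 7 (368/100) (564/100)"
    and supports_brooms_8: "supports_brooms c 8 (2016/100) (2200/100)"
proof -
  show 1: "supports_brooms c 1 (1/2) (1/2)"
    using supports_brooms_Suc[OF supports_brooms_0, of "1/2" "1/2"] by simp
  show 2: "supports_brooms c 2 (88/100) (113/100)"
    using supports_brooms_Suc[OF 1, of "88/100" "113/100"]
    by (simp add: power2_eq_square flip: numeral_2_eq_2)
  show 3: "supports_brooms c 3 (125/100) (181/100)"
    using supports_brooms_Suc[OF 2, of "125/100" "181/100"] by (simp add: power2_eq_square)
  show 4: "supports_brooms c 4 (165/100) (255/100)"
    using supports_brooms_Suc[OF 3, of "165/100" "255/100"] by (simp add: power2_eq_square)
  show 5: "supports_brooms c 5 (202/100) (336/100)"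
    using supports_brooms_Suc[OF 4, of "202/100" "336/100"] by (simp add: power2_eq_square)
  show 6: "supports_brooms c 6 (256/100) (427/100)"
    using supports_brooms_Suc[OF 5, of "256/100" "427/100"] by (simp add: power2_eq_square)
  show 7: "supports_brooms c 7 (368/100) (564/100)"
    using supports_brooms_Suc[OF 6, of "368/100" "564/100"] by (simp add: power2_eq_square)
  show 8: "supports_brooms c 8 (2016/100) (2200/100)"
    using supports_brooms_Suc[OF 7, of "2016/100" "2200/100"] by (simp add: power2_eq_square)
qed

text \<open>For the few vectors that hang beside the heavy branch, the directions close to the root \<open>x\<close> matter
  most. There a bound is good if \<open>D - \<rho>\<close> is large, which a larger \<open>D\<close> achieves at the expense of the
  other directions.\<close>

lemma side_balls:
  shows supports_brooms_2': "supports_brooms c 2 (136/100) (145/100)"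
    and supports_brooms_3': "supports_brooms c 3 (249/100) (275/100)"
    and supports_brooms_4': "supports_brooms c 4 (457/100) (503/100)"
  using supports_brooms_Suc[OF supports_brooms_1[of c], of "136/100" "145/100"]
    supports_brooms_Suc[OF supports_brooms_2[of c], of "249/100" "275/100"]
    supports_brooms_Suc[OF supports_brooms_3[of c], of "457/100" "503/100"]
  by (simp_all add: power2_eq_square flip: numeral_2_eq_2)

section \<open>Ten vectors do not balance\<close>

text \<open>If the total were zero, the vector \<open>(1 + D1) *\<^sub>R x + (1 + D2) *\<^sub>R y\<close> would have length at most
  \<open>\<rho>1 * norm x + \<rho>2 * norm y\<close>. As \<open>y\<close> lies in the Thales ball of \<open>x\<close>, its squared length is at least
  \<open>(1 + D1)\<^sup>2 * h\<^sup>2 + (2 * (1 + D1) * (1 + D2) + (1 + D2)\<^sup>2) * e\<^sup>2\<close>, with \<open>h\<close> and \<open>e\<close> standing for the two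
  norms. By \<open>sep\<close>, this exceeds \<open>(\<rho>1 * h + \<rho>2 * e)\<^sup>2\<close>.\<close>

lemma two_balls_avoid_zero:
  fixes x y s t :: "'a::real_inner"
  assumes s: "norm (s - D1 *\<^sub>R x) \<le> \<rho>1 * norm x" and t: "norm (t - D2 *\<^sub>R y) \<le> \<rho>2 * norm y"
    and yx: "y \<bullet> y \<le> x \<bullet> y" and x: "x \<noteq> 0"
    and nonneg: "0 \<le> D1" "0 \<le> D2"
    and sep: "0 < 2 * (1 + D1) * (1 + D2) + (1 + D2)\<^sup>2 - \<rho>2\<^sup>2"
      "(\<rho>1 * \<rho>2)\<^sup>2 < ((1 + D1)\<^sup>2 - \<rho>1\<^sup>2) * (2 * (1 + D1) * (1 + D2) + (1 + D2)\<^sup>2 - \<rho>2\<^sup>2)"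
  shows "x + s + (y + t) \<noteq> 0"
proof
  assume zero: "x + s + (y + t) = 0"
  define h e where "h = norm x" and "e = norm y"
  have h: "0 < h" using x by (simp add: h_def)
  have "(1 + D1) *\<^sub>R x + (1 + D2) *\<^sub>R y = x + s + (y + t) - ((s - D1 *\<^sub>R x) + (t - D2 *\<^sub>R y))"
    by (simp add: algebra_simps)
  then have "norm ((1 + D1) *\<^sub>R x + (1 + D2) *\<^sub>R y) = norm ((s - D1 *\<^sub>R x) + (t - D2 *\<^sub>R y))"
    unfolding zero diff_0 by (simp only: norm_minus_cancel)
  also have "\<dots> \<le> \<rho>1 * h + \<rho>2 * e"
    unfolding h_def e_def by (rule norm_triangle_le) (use s t in linarith)
  finally have "(norm ((1 + D1) *\<^sub>R x + (1 + D2) *\<^sub>R y))\<^sup>2 \<le> (\<rho>1 * h + \<rho>2 * e)\<^sup>2"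
    by (intro power_mono) auto
  moreover have "(norm ((1 + D1) *\<^sub>R x + (1 + D2) *\<^sub>R y))\<^sup>2
      = (1 + D1)\<^sup>2 * h\<^sup>2 + 2 * (1 + D1) * (1 + D2) * (x \<bullet> y) + (1 + D2)\<^sup>2 * e\<^sup>2"
    unfolding h_def e_def power2_norm_eq_inner
    by (simp add: inner_add_left inner_add_right inner_commute power2_eq_square algebra_simps)
  moreover have "2 * (1 + D1) * (1 + D2) * e\<^sup>2 \<le> 2 * (1 + D1) * (1 + D2) * (x \<bullet> y)"
    using yx nonneg unfolding e_def power2_norm_eq_inner by (intro mult_left_mono) auto
  ultimately show False
    using binary_form_pos[OF sep h, of e] by (simp add: power2_eq_square algebra_simps)
qed

text \<open>In the direction of \<open>x\<close> itself, the ball around \<open>D *\<^sub>R y\<close> and \<open>norm y ^ 2 \<le> x \<bullet> y\<close> turn the inner product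
  into a quadratic polynomial in \<open>norm x\<close> and \<open>norm y\<close>.\<close>

lemma branch_ge_of_ball:
  fixes x y t :: "'a::real_inner"
  assumes ball: "\<And>c::'a. supports_brooms c m D \<rho>" and nonneg: "0 \<le> D" "0 \<le> \<rho>" "0 \<le> k"
    and disc: "\<rho>\<^sup>2 \<le> 4 * (1 + D) * k"
    and yx: "y \<bullet> y \<le> x \<bullet> y" and t: "fan y m t"
  shows "- k * (x \<bullet> x) \<le> x \<bullet> (y + t)"
proof -
  define h e where "h = norm x" and "e = norm y"
  have "norm x * norm (t - D *\<^sub>R y) \<le> h * (\<rho> * e)"
    unfolding h_def e_def
    using fan_in_ball[OF ball nonneg(2) t] by (intro mult_left_mono) auto
  moreover have "- (norm x * norm (t - D *\<^sub>R y)) \<le> x \<bullet> (t - D *\<^sub>R y)"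
    using Cauchy_Schwarz_ineq2[of x "t - D *\<^sub>R y"] by linarith
  moreover have "(1 + D) * e\<^sup>2 \<le> (1 + D) * (x \<bullet> y)"
    using yx nonneg unfolding e_def power2_norm_eq_inner by (intro mult_left_mono) auto
  moreover have "0 \<le> k * h\<^sup>2 - 2 * (\<rho> / 2) * (h * e) + (1 + D) * e\<^sup>2"
    using disc nonneg by (intro binary_form_nonneg) (auto simp: power2_eq_square field_simps)
  moreover have "x \<bullet> x = h\<^sup>2" by (simp add: h_def power2_norm_eq_inner)
  ultimately show ?thesis
    by (simp add: inner_diff_right inner_add_right algebra_simps)
qed

text \<open>Branches of up to four vectors cost at most a tenth of \<open>x \<bullet> x\<close> per vector, so nine vectors in such
  branches cannot outweigh \<open>x\<close>. Branches of five vectors can cost more than a ninth per vector.\<close>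

lemma light_branch:
  fixes x y t :: "'a::real_inner"
  assumes yx: "y \<bullet> y \<le> x \<bullet> y" and t: "fan y m t" and "m < 4"
  shows "- (real (m + 1) / 10) * (x \<bullet> x) \<le> x \<bullet> (y + t)"
proof -
  note ge = branch_ge_of_ball[OF _ _ _ _ _ yx]
  consider "m = 0" | "m = 1" | "m = 2" | "m = 3" using assms(3) by linarith
  then show ?thesis
  proof cases
    case 1
    show ?thesis using ge[OF supports_brooms_0, of "1/10" t] t 1 by simp
  next
    case 2
    show ?thesis using ge[OF supports_brooms_1, of "2/10" t] t 2 by (simp add: power2_eq_square)
  next
    case 3
    show ?thesis using ge[OF supports_brooms_2, of "3/10" t] t 3 by (simp add: power2_eq_square)
  next
    case 4
    show ?thesis using ge[OF supports_brooms_3, of "4/10" t] t 4 by (simp add: power2_eq_square)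
  qed
qed

lemma fan_heavy_or_light:
  assumes "fan x n s"
  shows "(\<exists>y m t n' s'. y \<bullet> y \<le> x \<bullet> y \<and> fan y m t \<and> fan x n' s' \<and>
            n = n' + m + 1 \<and> s = s' + (y + t) \<and> 4 \<le> m)
       \<or> - (real n / 10) * (x \<bullet> x) \<le> x \<bullet> s"
  using assms
proof (induction rule: fan.induct)
  case (empty x)
  then show ?case by simp
next
  case (branch x n s y m t)
  consider "4 \<le> m"
    | "m < 4" "- (real n / 10) * (x \<bullet> x) \<le> x \<bullet> s"
    | (heavy) y' m' t' n' s' where "y' \<bullet> y' \<le> x \<bullet> y'" "fan y' m' t'" "fan x n' s'"
        "n = n' + m' + 1" "s = s' + (y' + t')" "4 \<le> m'"
    using branch.IH(1) by force
  then show ?case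
  proof cases
    case 1
    then show ?thesis using branch.hyps by blast
  next
    case 2
    then show ?thesis
      using light_branch[OF branch.hyps(2,3)] by (simp add: inner_add_right field_simps)
  next
    case heavy
    have "fan x (n' + m + 1) (s' + (y + t))"
      using fan.branch[OF heavy(3) branch.hyps(2,3)] .
    moreover have "n + m + 1 = (n' + m + 1) + m' + 1"
      "s + (y + t) = (s' + (y + t)) + (y' + t')"
      using heavy(4,5) by (simp_all add: algebra_simps)
    ultimately show ?thesis using heavy(1,2,6) by blast
  qed
qed

text \<open>With a heavy branch of \<open>m + 1 \<ge> 5\<close> vectors at \<open>y\<close>, only \<open>n' = 8 - m \<le> 4\<close> vectors are left to hang
  elsewhere under \<open>x\<close>, which leaves five cases.\<close>

lemma ten_vectors_do_not_balance:
  fixes x s :: "'a::real_inner"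
  assumes "fan x n s" "n \<le> 9" "x + s = 0"
  shows "x = 0"
proof (rule ccontr)
  assume x: "x \<noteq> 0"
  have fan: "fan x 9 s" using fan_pad[OF assms(1), of "9 - n"] assms(2) by simp
  have "x \<bullet> s = - (x \<bullet> x)" using assms(3) by (metis add_eq_0_iff inner_minus_right)
  show False
    using fan_heavy_or_light[OF fan]
  proof (elim disjE exE conjE)
    assume "- (real 9 / 10) * (x \<bullet> x) \<le> x \<bullet> s"
    then show False
      using \<open>x \<bullet> s = - (x \<bullet> x)\<close> x by simp
  next
    fix y m t n' s'
    assume yx: "y \<bullet> y \<le> x \<bullet> y" and t: "fan y m t" and s': "fan x n' s'"
      and n: "9 = n' + m + 1" and s: "s = s' + (y + t)" and m: "4 \<le> m"
    have "x + s' + (y + t) = 0" using assms(3) s by (simp add: algebra_simps)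
    then have avoid: False
      if "\<And>c::'a. supports_brooms c n' D1 \<rho>1" "\<And>c::'a. supports_brooms c m D2 \<rho>2"
        "0 \<le> D1" "0 \<le> D2" "0 \<le> \<rho>1" "0 \<le> \<rho>2"
        "0 < 2 * (1 + D1) * (1 + D2) + (1 + D2)\<^sup>2 - \<rho>2\<^sup>2"
        "(\<rho>1 * \<rho>2)\<^sup>2 < ((1 + D1)\<^sup>2 - \<rho>1\<^sup>2) * (2 * (1 + D1) * (1 + D2) + (1 + D2)\<^sup>2 - \<rho>2\<^sup>2)"
      for D1 \<rho>1 D2 \<rho>2
      using two_balls_avoid_zero[OF fan_in_ball[OF that(1,5) s'] fan_in_ball[OF that(2,6) t] yx x]
        that(3-8) by blast
    consider "n' = 0" "m = 8" | "n' = 1" "m = 7" | "n' = 2" "m = 6" | "n' = 3" "m = 5" | "n' = 4" "m = 4"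
      using n m by linarith
    then show False
    proof cases
      case 1
      show False
        by (rule avoid[unfolded 1, OF supports_brooms_0 supports_brooms_8])
          (simp_all add: power2_eq_square)
    next
      case 2
      show False
        by (rule avoid[unfolded 2, OF supports_brooms_1 supports_brooms_7])
          (simp_all add: power2_eq_square)
    next
      case 3
      show False
        by (rule avoid[unfolded 3, OF supports_brooms_2' supports_brooms_6])
          (simp_all add: power2_eq_square)
    next
      case 4
      show False
        by (rule avoid[unfolded 4, OF supports_brooms_3' supports_brooms_5])
          (simp_all add: power2_eq_square)
    next
      case 5
      show False
        by (rule avoid[unfolded 5, OF supports_brooms_4' supports_brooms_4])
          (simp_all add: power2_eq_square)
    qed
  qed
qed

section \<open>Unstable vertices\<close>

lemma polytope_eq_hull_vertices:
  fixes P :: "'a::euclidean_space set"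
  assumes "polytope P"
  shows "P = convex hull (vertices P)"
  unfolding vertices_def
  by (intro Krein_Milman_Minkowski polytope_imp_compact polytope_imp_convex assms)

lemma finite_vertices:
  fixes P :: "'a::euclidean_space set"
  assumes "polytope P"
  shows "finite (vertices P)"
  using finite_polyhedron_extreme_points[of P] assms polytope_imp_polyhedron
  by (auto simp: vertices_def)

text \<open>The vertex \<open>q\<close> together with the open half-space below its hyperplane is convex and contains all
  vertices, so it contains \<open>P\<close>. Hence the hyperplane touches \<open>P\<close> in \<open>q\<close> only.\<close>

lemma unstable_equilibriumI:
  fixes P :: "'a::euclidean_space set"
  assumes "polytope P" "q \<in> vertices P" "v0 \<in> vertices P" "v0 \<noteq> q"
    and strict: "\<And>v. \<lbrakk>v \<in> vertices P; v \<noteq> q\<rbrakk> \<Longrightarrow> (q - g) \<bullet> (v - q) < 0"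
  shows "unstable_equilibrium P g q"
proof -
  define H where "H = {x. (q - g) \<bullet> (x - q) < 0}"
  have ext: "q extreme_point_of P" using assms(2) by (simp add: vertices_def)
  have qg: "q - g \<noteq> 0" using strict[OF assms(3,4)] by auto
  have hull: "P = convex hull (vertices P)"
    by (rule polytope_eq_hull_vertices[OF assms(1)])
  have "convex (insert q H)"
  proof (rule convexI)
    fix x y :: 'a and u v :: real
    assume xy: "x \<in> insert q H" "y \<in> insert q H" and uv: "0 \<le> u" "0 \<le> v" "u + v = 1"
    have eq: "u *\<^sub>R x + v *\<^sub>R y - q = u *\<^sub>R (x - q) + v *\<^sub>R (y - q)"
      using uv(3) by (simp add: algebra_simps flip: scaleR_add_left)
    show "u *\<^sub>R x + v *\<^sub>R y \<in> insert q H"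
    proof (cases "(u = 0 \<or> x = q) \<and> (v = 0 \<or> y = q)")
      case True
      then have "u *\<^sub>R x + v *\<^sub>R y - q = 0" unfolding eq by auto
      then show ?thesis by simp
    next
      case False
      have "u * ((q - g) \<bullet> (x - q)) \<le> 0" "v * ((q - g) \<bullet> (y - q)) \<le> 0"
        using xy uv by (auto simp: H_def mult_le_0_iff)
      moreover have "u * ((q - g) \<bullet> (x - q)) < 0 \<or> v * ((q - g) \<bullet> (y - q)) < 0"
        using xy uv False by (auto simp: H_def mult_less_0_iff)
      ultimately have "(q - g) \<bullet> (u *\<^sub>R x + v *\<^sub>R y - q) < 0"
        unfolding eq by (auto simp: inner_add_right)
      then show ?thesis by (simp add: H_def)
    qed
  qed
  moreover have "vertices P \<subseteq> insert q H" using strict by (auto simp: H_def)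
  ultimately have sub: "P \<subseteq> insert q H" using hull hull_minimal by metis
  have qP: "q \<in> P" using ext by (simp add: extreme_point_of_def)
  have single: "perp_hyperplane g q \<inter> P = {q}"
    using sub qP by (auto simp: perp_hyperplane_def H_def)
  have "q \<notin> interior P" using ext extreme_point_not_in_interior by blast
  then have fr: "q \<in> frontier P" using qP closure_subset by (auto simp: frontier_def)
  have "supports_at (perp_hyperplane g q) P q"
    unfolding supports_at_def
  proof (intro conjI exI)
    show "q \<in> perp_hyperplane g q \<inter> P" using single by simp
    show "perp_hyperplane g q = {x. (q - g) \<bullet> x = (q - g) \<bullet> q}"
      by (simp add: perp_hyperplane_def inner_diff_right)
    show "P \<subseteq> {x. (q - g) \<bullet> x \<le> (q - g) \<bullet> q}"
      using sub by (force simp: H_def inner_diff_right)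
  qed (rule qg)
  moreover have "{F. F face_of P \<and> 0 \<le> aff_dim F \<and> aff_dim F \<le> int DIM('a) - 1 \<and> q \<in> rel_interior F}
      = {{q}}"
  proof -
    have q: "{q} face_of P" using ext by (simp add: face_of_singleton)
    have unique: "F = {q}" if "F face_of P" "q \<in> rel_interior F" for F
    proof (rule face_of_eq[OF that(1) q])
      have "q \<in> rel_interior F \<inter> rel_interior {q}" using that(2) by simp
      then show "rel_interior F \<inter> rel_interior {q} \<noteq> {}" by blast
    qed
    have dim: "0 \<le> aff_dim {q}" "aff_dim {q} \<le> int DIM('a) - 1"
      using DIM_positive[where 'a='a] by simp_all
    show ?thesis
    proof (intro equalityI subsetI)
      fix F assume "F \<in> {F. F face_of P \<and> 0 \<le> aff_dim F \<and> aff_dim F \<le> int DIM('a) - 1 \<and> q \<in> rel_interior F}"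
      then show "F \<in> {{q}}" using unique by blast
    next
      fix F assume "F \<in> {{q}}"
      then have "F = {q}" by simp
      then show "F \<in> {F. F face_of P \<and> 0 \<le> aff_dim F \<and> aff_dim F \<le> int DIM('a) - 1 \<and> q \<in> rel_interior F}"
        using q dim by simp
    qed
  qed
  ultimately show ?thesis
    using fr single
    by (simp add: unstable_equilibrium_def nondegenerate_equilibrium_def equilibrium_def)
qed

text \<open>The hyperplane meets \<open>P\<close> in \<open>q\<close> alone, so another vertex \<open>v\<close> that is not strictly below it lies
  strictly above, while \<open>g\<close> lies strictly below. A hyperplane with points of \<open>P\<close> strictly on both sides
  supports nothing.\<close>

lemma unstable_equilibriumD:
  fixes P :: "'a::euclidean_space set"
  assumes "unstable_equilibrium P g q" "g \<in> P"
  shows "q \<in> vertices P" "\<And>v. \<lbrakk>v \<in> vertices P; v \<noteq> q\<rbrakk> \<Longrightarrow> (q - g) \<bullet> (v - q) < 0"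
proof -
  have sup: "supports_at (perp_hyperplane g q) P q"
    and dim: "aff_dim (perp_hyperplane g q \<inter> P) = 0"
    and face: "perp_hyperplane g q \<inter> P face_of P"
    using assms(1)
    unfolding unstable_equilibrium_def nondegenerate_equilibrium_def equilibrium_def by blast+
  obtain a b where a: "a \<noteq> 0" "perp_hyperplane g q = {x. a \<bullet> x = b}" "P \<subseteq> {x. a \<bullet> x \<le> b}"
    and q: "q \<in> perp_hyperplane g q \<inter> P"
    using sup unfolding supports_at_def by blast
  have single: "perp_hyperplane g q \<inter> P = {q}"
    using dim q by (metis aff_dim_eq_0 singletonD)
  then show "q \<in> vertices P" using face by (simp add: vertices_def face_of_singleton)
  have "q \<noteq> g"
  proof
    assume "q = g"
    then have "{x. a \<bullet> x = b} = UNIV" using a(2) by (simp add: perp_hyperplane_def)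
    then have "a \<bullet> 0 = b" "a \<bullet> a = b" by (metis UNIV_I mem_Collect_eq)+
    then show False using a(1) by simp
  qed
  fix v assume v: "v \<in> vertices P" "v \<noteq> q"
  then have vP: "v \<in> P" by (simp add: vertices_def extreme_point_of_def)
  show "(q - g) \<bullet> (v - q) < 0"
  proof (rule ccontr)
    assume "\<not> (q - g) \<bullet> (v - q) < 0"
    moreover have "v \<notin> perp_hyperplane g q" using single vP v(2) by auto
    ultimately have pos: "0 < (q - g) \<bullet> (v - q)" by (auto simp: perp_hyperplane_def)
    define k where "k = (q - g) \<bullet> (v - q)"
    define l where "l = (q - g) \<bullet> (q - g)"
    have l: "0 < l" using \<open>q \<noteq> g\<close> by (simp add: l_def)
    \<comment> \<open>The weights make this positive combination of \<open>v - q\<close> and \<open>g - q\<close> parallel to the hyperplane.\<close>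
    have "(q - g) \<bullet> (l *\<^sub>R (v - q) + k *\<^sub>R (g - q)) = l * k - k * l"
      unfolding k_def l_def by (simp add: inner_add_right inner_diff_right) (simp add: algebra_simps)
    then have "q + (l *\<^sub>R (v - q) + k *\<^sub>R (g - q)) \<in> perp_hyperplane g q"
      by (simp add: perp_hyperplane_def)
    then have "a \<bullet> (q + (l *\<^sub>R (v - q) + k *\<^sub>R (g - q))) = b"
      unfolding a(2) by simp
    moreover have "a \<bullet> q = b" using a(2) q by auto
    moreover have "a \<bullet> v < b" using a vP \<open>v \<notin> perp_hyperplane g q\<close> by fastforce
    moreover have "a \<bullet> g \<le> b" using a(3) assms(2) by auto
    moreover have "l * (a \<bullet> v) < l * b" using calculation(3) l by simp
    moreover have "k * (a \<bullet> g) \<le> k * b" using calculation(4) pos by (simp add: k_def mult_left_mono)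
    ultimately show False
      by (simp add: inner_add_right inner_diff_right algebra_simps)
  qed
qed

lemma skeleton0_center_in:
  fixes P :: "'a::euclidean_space set"
  assumes "polytope P" "P \<noteq> {}"
  shows "skeleton0_center P \<in> P"
proof -
  have hull: "P = convex hull (vertices P)"
    by (rule polytope_eq_hull_vertices[OF assms(1)])
  have fin: "finite (vertices P)" "vertices P \<noteq> {}"
    using finite_vertices[OF assms(1)] hull assms(2) by (metis convex_hull_empty)+
  have "(\<Sum>v\<in>vertices P. (1 / real (card (vertices P))) *\<^sub>R v) \<in> convex hull (vertices P)"
    by (rule convex_sum) (use fin in \<open>auto intro: hull_inc\<close>)
  then show ?thesis
    unfolding hull[symmetric] by (simp add: skeleton0_center_def scaleR_sum_right)
qed

text \<open>The bound on trees of vectors holds in every inner product space, so the polytope may have any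
  positive dimension. The parent of a vertex is any vertex that prevents it from being unstable.\<close>

lemma mono_unstable_needs_eleven_vertices:
  fixes P :: "'a::euclidean_space set"
  assumes P: "polytope P" "0 < aff_dim P" and mono: "mono_unstable_0_skeleton P"
  shows "11 \<le> card (vertices P)"
proof (rule ccontr)
  assume few: "\<not> 11 \<le> card (vertices P)"
  define V g where "V = vertices P" and "g = skeleton0_center P"
  have hull: "P = convex hull V"
    unfolding V_def by (rule polytope_eq_hull_vertices[OF P(1)])
  have fin: "finite V"
    unfolding V_def by (rule finite_vertices[OF P(1)])
  have two: "\<exists>v\<in>V. v \<noteq> q" for q
  proof (rule ccontr)
    assume "\<not> (\<exists>v\<in>V. v \<noteq> q)"
    then have "V \<subseteq> {q}" by auto
    then have "aff_dim P \<le> aff_dim {q}" unfolding hull aff_dim_convex_hull by (rule aff_dim_subset)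
    then show False using P(2) by simp
  qed
  then have "V \<noteq> {}" by blast
  define W where "W = (\<lambda>v. v - g) ` V"
  have finW: "finite W" and cardW: "card W = card V"
    using fin by (auto simp: W_def card_image inj_on_def)
  have sumW: "\<Sum>W = 0"
  proof -
    have "\<Sum>W = (\<Sum>v\<in>V. v - g)"
      unfolding W_def by (subst sum.reindex) (auto simp: inj_on_def)
    also have "\<dots> = (\<Sum>v\<in>V. v) - real (card V) *\<^sub>R g"
      by (simp add: sum_subtractf sum_constant_scaleR)
    also have "real (card V) *\<^sub>R g = (\<Sum>v\<in>V. v)"
      using fin \<open>V \<noteq> {}\<close> by (simp add: g_def skeleton0_center_def V_def)
    finally show ?thesis by simp
  qed
  have "Max (norm ` W) \<in> norm ` W"
    using \<open>V \<noteq> {}\<close> finW by (intro Max_in) (auto simp: W_def)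
  then obtain r where r: "r \<in> W" "norm r = Max (norm ` W)" by auto
  then have rmax: "norm w \<le> norm r" if "w \<in> W" for w using that finW by simp
  have strict: "r \<bullet> w < r \<bullet> r" if "w \<in> W" "w \<noteq> r" for w
  proof -
    have "0 < (w - r) \<bullet> (w - r)" using that by simp
    moreover have "w \<bullet> w \<le> r \<bullet> r" using rmax[OF that(1)] by (simp add: norm_le)
    ultimately show ?thesis by (simp add: inner_diff inner_commute)
  qed
  have unst: "unstable_equilibrium P g (q + g)"
    if q: "q \<in> W" and s: "\<And>w. \<lbrakk>w \<in> W; w \<noteq> q\<rbrakk> \<Longrightarrow> q \<bullet> w < q \<bullet> q" for q
  proof -
    obtain v0 where "v0 \<in> V" "v0 \<noteq> q + g" using two by blast
    moreover have "(q + g - g) \<bullet> (v - (q + g)) < 0" if "v \<in> V" "v \<noteq> q + g" for v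
    proof -
      have "q \<bullet> (v - g) < q \<bullet> q" using that by (intro s) (auto simp: W_def)
      then show ?thesis by (simp add: inner_diff_right inner_add_right)
    qed
    ultimately show ?thesis
      using q unfolding V_def by (intro unstable_equilibriumI[OF P(1)]) (auto simp: W_def V_def)
  qed
  have ex: "\<exists>w\<in>W. w \<noteq> q \<and> q \<bullet> q \<le> w \<bullet> q" if "q \<in> W" "q \<noteq> r" for q
  proof (rule ccontr)
    assume "\<not> ?thesis"
    then have "unstable_equilibrium P g (q + g)"
      using that by (intro unst) (auto simp: inner_commute not_le)
    moreover have "unstable_equilibrium P g (r + g)" using r strict by (intro unst)
    moreover obtain z where "{q. unstable_equilibrium P g q} = {z}"
      using mono unfolding mono_unstable_0_skeleton_def num_unstable_def g_def
      by (auto simp: card_1_singleton_iff)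
    ultimately have "q + g = r + g" by (metis mem_Collect_eq singletonD)
    then show False using that by simp
  qed
  define par where "par q = (SOME w. w \<in> W \<and> w \<noteq> q \<and> q \<bullet> q \<le> w \<bullet> q)" for q
  have par: "par q \<in> W \<and> par q \<noteq> q \<and> q \<bullet> q \<le> par q \<bullet> q" if "q \<in> W - {r}" for q
    unfolding par_def by (rule someI_ex) (use ex that in blast)
  have "fan r (card (W - {r})) (\<Sum>(W - {r}))"
  proof (rule fan_of_parents)
    fix v assume v: "v \<in> W - {r}"
    have "0 < (par v - v) \<bullet> (par v - v)" using par[OF v] by simp
    then have "v \<bullet> v < par v \<bullet> par v"
      using par[OF v] by (simp add: inner_diff inner_commute)
    then show "norm v < norm (par v)" by (simp add: norm_lt)
  qed (use finW par in auto)
  moreover have "card (W - {r}) \<le> 9" using few cardW r finW by (simp add: V_def)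
  moreover have "r + \<Sum>(W - {r}) = 0" using sum.remove[OF finW r(1), of "\<lambda>v. v"] sumW by simp
  ultimately have "r = 0" by (rule ten_vectors_do_not_balance)
  then have "v = g" if "v \<in> V" for v using rmax[of "v - g"] that by (auto simp: W_def)
  then show False using two[of g] by blast
qed

section \<open>A mono-unstable polytope with eleven vertices\<close>

text \<open>A point that some linear functional separates from all the others is not in their hull.\<close>

lemma vertices_convex_hull:
  fixes X :: "'a::euclidean_space set"
  assumes "finite X" and "\<And>x. x \<in> X \<Longrightarrow> \<exists>a. \<forall>y\<in>X. y \<noteq> x \<longrightarrow> a \<bullet> y < a \<bullet> x"
  shows "vertices (convex hull X) = X"
proof
  show "vertices (convex hull X) \<subseteq> X"
    by (auto simp: vertices_def dest: extreme_point_of_convex_hull)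
  show "X \<subseteq> vertices (convex hull X)"
  proof
    fix x assume x: "x \<in> X"
    then obtain a where a: "\<forall>y\<in>X. y \<noteq> x \<longrightarrow> a \<bullet> y < a \<bullet> x" using assms(2) by blast
    have "convex hull (X - {x}) \<subseteq> {y. a \<bullet> y < a \<bullet> x}"
      using a by (intro hull_minimal) (auto simp: convex_halfspace_lt)
    then have "x \<notin> convex hull (X - {x})" by blast
    then have "x extreme_point_of convex hull (insert x (X - {x}))"
      using assms(1) by (intro extreme_point_of_convex_hull_insert) auto
    then show "x \<in> vertices (convex hull X)"
      using x by (simp add: vertices_def insert_absorb)
  qed
qed

definition pt :: "real \<Rightarrow> real \<Rightarrow> real \<Rightarrow> real^3" where
  "pt a b c = vector [a, b, c]"

lemma inner_pt: "pt a b c \<bullet> pt a' b' c' = a * a' + b * b' + c * c'"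
  by (simp add: pt_def inner_vec_def sum_3)

lemma pt_eq_iff: "pt a b c = pt a' b' c' \<longleftrightarrow> a = a' \<and> b = b' \<and> c = c'"
  by (simp add: pt_def vec_eq_iff forall_3)

lemma pt_add: "pt a b c + pt a' b' c' = pt (a + a') (b + b') (c + c')"
  by (simp add: pt_def vec_eq_iff forall_3)

lemma pt_diff: "pt a b c - pt a' b' c' = pt (a - a') (b - b') (c - c')"
  by (simp add: pt_def vec_eq_iff forall_3)

lemma pt_0: "pt 0 0 0 = 0"
  by (simp add: pt_def vec_eq_iff forall_3)

lemma pt_cases: "\<exists>a b c. x = pt a b c"
  by (rule exI[of _ "x $ 1"], rule exI[of _ "x $ 2"], rule exI[of _ "x $ 3"])
    (simp add: pt_def vec_eq_iff forall_3)

text \<open>The set is invariant under the half-turn about the first axis, so that only the first coordinates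
  have to be balanced. Each point on either side has the preceding point of that side as its
  parent, beginning with the common root \<open>pt 20 0 0\<close>. The Thales condition is an equality for
  several points, but not for \<open>pt 6 9 1\<close>, which is why this pair can leave the plane of the others.\<close>

definition eleven_points :: "(real^3) set" where
  "eleven_points =
     {pt 20 0 0, pt 6 9 1, pt 6 (-9) (-1), pt (-1) 8 0, pt (-1) (-8) 0, pt (-4) 6 0, pt (-4) (-6) 0,
      pt (-5) 5 0, pt (-5) (-5) 0, pt (-6) 2 0, pt (-6) (-2) 0}"

lemma finite_eleven_points: "finite eleven_points"
  by (simp add: eleven_points_def)

lemma card_eleven_points: "card eleven_points = 11"
  by (simp add: eleven_points_def pt_eq_iff)

lemma vertices_eleven_points: "vertices (convex hull eleven_points) = eleven_points"
proof (rule vertices_convex_hull[OF finite_eleven_points])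
  fix x assume "x \<in> eleven_points"
  \<comment> \<open>The functionals are read off from the normal vectors of the plane polygon at its corners.\<close>
  moreover have "\<forall>y\<in>eleven_points. y \<noteq> pt 20 0 0 \<longrightarrow> pt 1 0 0 \<bullet> y < pt 1 0 0 \<bullet> pt 20 0 0"
    "\<forall>y\<in>eleven_points. y \<noteq> pt 6 9 1 \<longrightarrow> pt 1 2 0 \<bullet> y < pt 1 2 0 \<bullet> pt 6 9 1"
    "\<forall>y\<in>eleven_points. y \<noteq> pt 6 (-9) (-1) \<longrightarrow> pt 1 (-2) 0 \<bullet> y < pt 1 (-2) 0 \<bullet> pt 6 (-9) (-1)"
    "\<forall>y\<in>eleven_points. y \<noteq> pt (-1) 8 0 \<longrightarrow> pt (-1) 4 0 \<bullet> y < pt (-1) 4 0 \<bullet> pt (-1) 8 0"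
    "\<forall>y\<in>eleven_points. y \<noteq> pt (-1) (-8) 0 \<longrightarrow> pt (-1) (-4) 0 \<bullet> y < pt (-1) (-4) 0 \<bullet> pt (-1) (-8) 0"
    "\<forall>y\<in>eleven_points. y \<noteq> pt (-4) 6 0 \<longrightarrow> pt (-3) 4 0 \<bullet> y < pt (-3) 4 0 \<bullet> pt (-4) 6 0"
    "\<forall>y\<in>eleven_points. y \<noteq> pt (-4) (-6) 0 \<longrightarrow> pt (-3) (-4) 0 \<bullet> y < pt (-3) (-4) 0 \<bullet> pt (-4) (-6) 0"
    "\<forall>y\<in>eleven_points. y \<noteq> pt (-5) 5 0 \<longrightarrow> pt (-2) 1 0 \<bullet> y < pt (-2) 1 0 \<bullet> pt (-5) 5 0"
    "\<forall>y\<in>eleven_points. y \<noteq> pt (-5) (-5) 0 \<longrightarrow> pt (-2) (-1) 0 \<bullet> y < pt (-2) (-1) 0 \<bullet> pt (-5) (-5) 0"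
    "\<forall>y\<in>eleven_points. y \<noteq> pt (-6) 2 0 \<longrightarrow> pt (-4) 1 0 \<bullet> y < pt (-4) 1 0 \<bullet> pt (-6) 2 0"
    "\<forall>y\<in>eleven_points. y \<noteq> pt (-6) (-2) 0 \<longrightarrow> pt (-4) (-1) 0 \<bullet> y < pt (-4) (-1) 0 \<bullet> pt (-6) (-2) 0"
    by (simp_all add: eleven_points_def inner_pt)
  ultimately show "\<exists>a. \<forall>y\<in>eleven_points. y \<noteq> x \<longrightarrow> a \<bullet> y < a \<bullet> x"
    unfolding eleven_points_def by (elim insertE emptyE) blast+
qed

lemma center_eleven_points: "skeleton0_center (convex hull eleven_points) = 0"
proof -
  have "(\<Sum>v\<in>eleven_points. v) = 0"
    by (simp add: eleven_points_def pt_eq_iff pt_add pt_0)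
  then show ?thesis by (simp add: skeleton0_center_def vertices_eleven_points)
qed

lemma aff_dim_eleven_points: "aff_dim (convex hull eleven_points) = 3"
proof (rule ccontr)
  assume "aff_dim (convex hull eleven_points) \<noteq> 3"
  then have "aff_dim eleven_points < DIM(real^3)"
    using aff_dim_le_DIM[of eleven_points] by (simp add: aff_dim_convex_hull)
  then obtain a b where a: "a \<noteq> 0" "eleven_points \<subseteq> {x. a \<bullet> x = b}"
    by (rule aff_lowdim_subset_hyperplane)
  obtain p q r where pqr: "a = pt p q r" using pt_cases by blast
  have "20 * p = b" "6 * p + 9 * q + r = b" "6 * p - 9 * q - r = b" "- p + 8 * q = b" "- p - 8 * q = b"
    using a(2) unfolding pqr eleven_points_def by (auto simp: inner_pt algebra_simps)
  then have "p = 0" "q = 0" "r = 0" by linarith+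
  then show False using a(1) pqr by (simp add: pt_0)
qed

lemma mono_unstable_eleven_points: "mono_unstable_0_skeleton (convex hull eleven_points)"
proof -
  let ?P = "convex hull eleven_points"
  have poly: "polytope ?P" using finite_eleven_points by (auto simp: polytope_def)
  have "0 \<in> ?P"
    using skeleton0_center_in[OF poly] center_eleven_points by (auto simp: eleven_points_def)
  have "unstable_equilibrium ?P 0 (pt 20 0 0)"
  proof (rule unstable_equilibriumI[OF poly])
    show "pt 6 9 1 \<in> vertices ?P" "pt 6 9 1 \<noteq> pt 20 0 0" "pt 20 0 0 \<in> vertices ?P"
      by (simp_all add: vertices_eleven_points pt_eq_iff) (simp_all add: eleven_points_def)
    show "(pt 20 0 0 - 0) \<bullet> (v - pt 20 0 0) < 0" if "v \<in> vertices ?P" "v \<noteq> pt 20 0 0" for v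
    proof -
      have "v \<in> eleven_points" using that(1) by (simp add: vertices_eleven_points)
      then show ?thesis using that(2) unfolding eleven_points_def by (auto simp: inner_pt pt_diff)
    qed
  qed
  moreover have "q = pt 20 0 0" if q: "unstable_equilibrium ?P 0 q" for q
  proof -
    have "q \<in> eleven_points" and less: "\<And>v. \<lbrakk>v \<in> eleven_points; v \<noteq> q\<rbrakk> \<Longrightarrow> q \<bullet> (v - q) < 0"
      using unstable_equilibriumD[OF q \<open>0 \<in> ?P\<close>] by (simp_all add: vertices_eleven_points)
    then show ?thesis
      using less[of "pt 20 0 0"] less[of "pt 6 9 1"] less[of "pt 6 (-9) (-1)"] less[of "pt (-1) 8 0"]
        less[of "pt (-1) (-8) 0"] less[of "pt (-4) 6 0"] less[of "pt (-4) (-6) 0"]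
        less[of "pt (-5) 5 0"] less[of "pt (-5) (-5) 0"]
      unfolding eleven_points_def by (elim insertE emptyE) (simp_all add: inner_pt pt_diff pt_eq_iff)
  qed
  ultimately have "{q. unstable_equilibrium ?P 0 q} = {pt 20 0 0}" by blast
  then show ?thesis
    by (simp add: mono_unstable_0_skeleton_def num_unstable_def center_eleven_points)
qed

theorem theorem3:
  shows "(\<exists>P :: (real^3) set. polytope P \<and> aff_dim P = 3 \<and>
            card (vertices P) = 11 \<and> mono_unstable_0_skeleton P) \<and>
         \<not> (\<exists>P :: (real^3) set. polytope P \<and> aff_dim P = 3 \<and>
            card (vertices P) < 11 \<and> mono_unstable_0_skeleton P)"
proof
  have "polytope (convex hull eleven_points)"
    using finite_eleven_points by (auto simp: polytope_def)
  then show "\<exists>P :: (real^3) set. polytope P \<and> aff_dim P = 3 \<and>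
      card (vertices P) = 11 \<and> mono_unstable_0_skeleton P"
    using aff_dim_eleven_points vertices_eleven_points card_eleven_points mono_unstable_eleven_points
    by metis
  show "\<not> (\<exists>P :: (real^3) set. polytope P \<and> aff_dim P = 3 \<and>
      card (vertices P) < 11 \<and> mono_unstable_0_skeleton P)"
    using mono_unstable_needs_eleven_vertices by (fastforce simp: not_less)
qed

end
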